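(* Let $S$ be a continuous t-conorm and $\rightharpoonup$ its residuum. Then for all $x,y,z\in[0,1]$, $$x\rightharpoonup y\le S\left(x\rightharpoonup z,\ z\rightharpoonup y\right).$$ Moreover, if $S$ is weaker than the Łukasiewicz t-conorm $S_L$, then the function $d:[0,1]^2\to[0,1]$ defined by $d(x,y)=x\rightharpoonup y$ if $x\le y$ and $d(x,y)=y\rightharpoonup x$ if $x>y$ (which coincides with $S(x\rightharpoonup y,\ y\rightharpoonup x)$, the truth function of the equivalence connective $\varphi\leftrightarrow\psi:=(\varphi\to\psi)\&(\psi\to\varphi)$) is a metric on $[0,1]$.
   Context: A continuous t-conorm is a function $S:[0,1]^2\to[0,1]$, continuous for the Euclidean topology, commutative, associative, non-decreasing in each argument, with $S(0,x)=x$ for all $x$. Its residuum $\rightharpoonup$ is given by $x\rightharpoonup y=\min\{z\in[0,1]: S(z,x)\ge y\}$, equivalently by the adjointness $S(z,x)\ge y$ iff $z\ge x\rightharpoonup y$. The Łukasiewicz t-conorm is $S_L(x,y)=\min\{x+y,1\}$. $S$ is weaker than $S_L$ if $S(x,y)\le S_L(x,y)$ for all $x,y\in[0,1]$. (In the "metric semantic" used here, $0$ stands for absolute truth, $1$ for absolute falsity, strong conjunction $\&$ is interpreted by $S$ and implication $\to$ by $\rightharpoonup$.) *)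

theory Defs
  imports "HOL-Analysis.Analysis"
begin

text \<open>
  A t-conorm is modelled by a total function on the reals of which only the values on the
  unit square matter; its values elsewhere are unconstrained.
\<close>

locale continuous_tconorm =
  fixes S :: "real \<Rightarrow> real \<Rightarrow> real"
  assumes closed: "\<And>x y. x \<in> {0..1} \<Longrightarrow> y \<in> {0..1} \<Longrightarrow> S x y \<in> {0..1}"
    and continuous: "continuous_on ({0..1} \<times> {0..1}) (\<lambda>(x, y). S x y)"
    and commute: "\<And>x y. x \<in> {0..1} \<Longrightarrow> y \<in> {0..1} \<Longrightarrow> S x y = S y x"
    and assoc: "\<And>x y z. x \<in> {0..1} \<Longrightarrow> y \<in> {0..1} \<Longrightarrow> z \<in> {0..1} \<Longrightarrow>
                  S (S x y) z = S x (S y z)"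
    and mono_left: "\<And>x x' y. x \<in> {0..1} \<Longrightarrow> x' \<in> {0..1} \<Longrightarrow> y \<in> {0..1} \<Longrightarrow> x \<le> x' \<Longrightarrow>
                  S x y \<le> S x' y"
    and mono_right: "\<And>x y y'. x \<in> {0..1} \<Longrightarrow> y \<in> {0..1} \<Longrightarrow> y' \<in> {0..1} \<Longrightarrow> y \<le> y' \<Longrightarrow>
                  S x y \<le> S x y'"
    and zero: "\<And>x. x \<in> {0..1} \<Longrightarrow> S 0 x = x"

definition residuum :: "(real \<Rightarrow> real \<Rightarrow> real) \<Rightarrow> real \<Rightarrow> real \<Rightarrow> real" where
  "residuum S x y = (LEAST z. z \<in> {0..1} \<and> S z x \<ge> y)"

definition lukasiewicz_tconorm :: "real \<Rightarrow> real \<Rightarrow> real" where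
  "lukasiewicz_tconorm x y = min (x + y) 1"

definition weaker_tconorm :: "(real \<Rightarrow> real \<Rightarrow> real) \<Rightarrow> (real \<Rightarrow> real \<Rightarrow> real) \<Rightarrow> bool" where
  "weaker_tconorm S T \<longleftrightarrow> (\<forall>x\<in>{0..1}. \<forall>y\<in>{0..1}. S x y \<le> T x y)"

text \<open>
  The value 0 off the unit square carries no meaning: \<^const>\<open>Metric_space\<close> requires
  nonnegativity and symmetry on the whole type, not only on the carrier.
\<close>

definition tconorm_dist :: "(real \<Rightarrow> real \<Rightarrow> real) \<Rightarrow> real \<Rightarrow> real \<Rightarrow> real" where
  "tconorm_dist S x y =
     (if x \<in> {0..1} \<and> y \<in> {0..1}
      then if x \<le> y then residuum S x y else residuum S y x
      else 0)"

lemma (in continuous_tconorm) residuum_is_min: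
  assumes x: "x \<in> {0..1}" and y: "y \<in> {0..1}"
  shows "residuum S x y \<in> {0..1}" and "S (residuum S x y) x \<ge> y"
    and "\<And>z. z \<in> {0..1} \<Longrightarrow> S z x \<ge> y \<Longrightarrow> residuum S x y \<le> z"
proof -
  let ?A = "{z \<in> {0..1}. S z x \<in> {y..}}"
  have "continuous_on {0..1} (\<lambda>z. (\<lambda>(x, y). S x y) (z, x))"
    by (rule continuous_on_compose2[OF continuous])
       (use x in \<open>auto intro: continuous_on_Pair continuous_on_const continuous_on_id\<close>)
  then have "continuous_on {0..1} (\<lambda>z. S z x)" by simp
  then have "closed ({0..1} \<inter> (\<lambda>z. S z x) -` {y..})"
    by (rule continuous_closed_preimage) auto
  then have "closed ?A"
    by (simp add: Int_def vimage_def)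
  moreover have "bounded ?A"
    by (rule bounded_subset[of "{0..1}"]) auto
  ultimately have "compact ?A"
    by (simp only: compact_eq_bounded_closed)
  moreover have "S 1 x \<ge> 1"
    using mono_right[of 1 0 x] commute[of 1 0] zero[of 1] x by auto
  then have "?A \<noteq> {}" using y by (auto intro!: exI[of _ 1])
  ultimately have "\<exists>m\<in>?A. \<forall>z\<in>?A. m \<le> z"
    by (rule compact_attains_inf)
  then obtain m where m: "m \<in> ?A" "\<And>z. z \<in> ?A \<Longrightarrow> m \<le> z"
    by blast
  have eq: "residuum S x y = m"
    unfolding residuum_def by (rule Least_equality) (use m in auto)
  show "residuum S x y \<in> {0..1}" "S (residuum S x y) x \<ge> y"
    "\<And>z. z \<in> {0..1} \<Longrightarrow> S z x \<ge> y \<Longrightarrow> residuum S x y \<le> z"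
    using m unfolding eq by auto
qed

lemma (in continuous_tconorm) residuum_adjoint:
  assumes "x \<in> {0..1}" "y \<in> {0..1}" "z \<in> {0..1}"
  shows "S z x \<ge> y \<longleftrightarrow> z \<ge> residuum S x y"
proof
  assume "S z x \<ge> y"
  then show "z \<ge> residuum S x y" by (rule residuum_is_min(3)[OF assms])
next
  assume "z \<ge> residuum S x y"
  then have "S (residuum S x y) x \<le> S z x"
    by (rule mono_left[OF residuum_is_min(1)[OF assms(1,2)] assms(3,1)])
  then show "S z x \<ge> y"
    using residuum_is_min(2)[OF assms(1,2)] by linarith
qed

end

theory Submission
  imports Defs
begin

text \<open>Everything rests on adjointness: \<open>S z x\<close> \<ge> \<open>y\<close> iff
  \<open>z\<close> \<ge> \<open>residuum S x y\<close>. To bound a residuum from above it suffices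
  to exhibit a point \<open>c\<close> with \<open>S c x\<close> \<ge> \<open>y\<close>;
  associativity shows that \<open>c = S (residuum S x z) (residuum S z y)\<close> is one, which
  gives \<open>residuum_transitive\<close>. Since 0 is neutral, a residuum vanishes exactly when its
  second argument is at most its first. Hence of the two residua of a pair at least one is 0, their
  \<open>S\<close>-combination is the other one, and both vanish only for equal points. If
  \<open>S\<close> lies below the truncated sum, transitivity turns into the triangle
  inequality.\<close>

context continuous_tconorm
begin

lemma zero_right: "x \<in> {0..1} \<Longrightarrow> S x 0 = x"
  using commute[of x 0] zero[of x] by simp

text \<open>The residuum from \<open>x\<close> to \<open>z\<close> lifts \<open>x\<close> to at
  least \<open>z\<close>, and the one from \<open>z\<close> to \<open>y\<close> lifts that to at
  least \<open>y\<close>. By associativity their combination lifts \<open>x\<close> to at least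
  \<open>y\<close>, so minimality of the residuum applies.\<close>

lemma residuum_transitive:
  assumes x: "x \<in> {0..1}" and y: "y \<in> {0..1}" and z: "z \<in> {0..1}"
  shows "residuum S x y \<le> S (residuum S x z) (residuum S z y)"
proof -
  let ?a = "residuum S x z" and ?b = "residuum S z y"
  have a: "?a \<in> {0..1}" and b: "?b \<in> {0..1}"
    by (rule residuum_is_min(1); fact)+
  have "y \<le> S ?b z"
    by (rule residuum_is_min(2)[OF z y])
  also have "\<dots> \<le> S ?b (S ?a x)"
    by (rule mono_right[OF b z closed[OF a x] residuum_is_min(2)[OF x z]])
  also have "\<dots> = S (S ?a ?b) x"
    using assoc[OF b a x] commute[OF a b] by simp
  finally show ?thesis
    by (rule residuum_is_min(3)[OF x y closed[OF a b]])
qed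

text \<open>Adjointness at the point 0, where \<open>S 0 x = x\<close>.\<close>

lemma residuum_eq_0_iff:
  assumes x: "x \<in> {0..1}" and y: "y \<in> {0..1}"
  shows "residuum S x y = 0 \<longleftrightarrow> y \<le> x"
  using residuum_adjoint[OF x y, of 0] residuum_is_min(1)[OF x y] zero[OF x] by auto

text \<open>The residuum in the non-increasing direction is 0, hence neutral for
  \<open>S\<close>.\<close>

lemma tconorm_dist_eq:
  assumes x: "x \<in> {0..1}" and y: "y \<in> {0..1}"
  shows "tconorm_dist S x y = S (residuum S x y) (residuum S y x)"
proof (cases "x \<le> y")
  case True
  then have "residuum S y x = 0"
    using residuum_eq_0_iff[OF y x] by simp
  then show ?thesis
    using True x y zero_right[OF residuum_is_min(1)[OF x y]] by (simp add: tconorm_dist_def)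
next
  case False
  then have "residuum S x y = 0"
    using residuum_eq_0_iff[OF x y] by simp
  then show ?thesis
    using False x y zero[OF residuum_is_min(1)[OF y x]] by (simp add: tconorm_dist_def)
qed

lemma tconorm_dist_in_unit:
  assumes "x \<in> {0..1}" "y \<in> {0..1}"
  shows "tconorm_dist S x y \<in> {0..1}"
  using assms residuum_is_min(1)[of x y] residuum_is_min(1)[of y x]
  by (simp add: tconorm_dist_def)

lemma tconorm_dist_commute: "tconorm_dist S x y = tconorm_dist S y x"
  by (auto simp: tconorm_dist_def)

text \<open>The distance dominates the residua in both directions. This spares the triangle
  inequality a case split on the position of the middle point.\<close>

lemma residuum_le_tconorm_dist:
  assumes x: "x \<in> {0..1}" and y: "y \<in> {0..1}"
  shows "residuum S x y \<le> tconorm_dist S x y"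
proof (cases "x \<le> y")
  case True
  then show ?thesis
    using x y by (simp add: tconorm_dist_def)
next
  case False
  then have "residuum S x y = 0"
    using residuum_eq_0_iff[OF x y] by simp
  then show ?thesis
    using tconorm_dist_in_unit[OF x y] by simp
qed

lemma tconorm_dist_eq_0_iff:
  assumes x: "x \<in> {0..1}" and y: "y \<in> {0..1}"
  shows "tconorm_dist S x y = 0 \<longleftrightarrow> x = y"
  using x y residuum_eq_0_iff[OF x y] residuum_eq_0_iff[OF y x]
  by (auto simp: tconorm_dist_def)

text \<open>A directed triangle inequality: the comparison with \<open>lukasiewicz_tconorm\<close>
  replaces \<open>S\<close> by ordinary addition, and dropping the truncation at 1 only enlarges the
  bound.\<close>

lemma residuum_le_dist_add_dist:
  assumes weaker: "weaker_tconorm S lukasiewicz_tconorm"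
    and x: "x \<in> {0..1}" and y: "y \<in> {0..1}" and z: "z \<in> {0..1}"
  shows "residuum S x z \<le> tconorm_dist S x y + tconorm_dist S y z"
proof -
  let ?a = "residuum S x y" and ?b = "residuum S y z"
  have a: "?a \<in> {0..1}" and b: "?b \<in> {0..1}"
    by (rule residuum_is_min(1); fact)+
  have "residuum S x z \<le> S ?a ?b"
    by (rule residuum_transitive[OF x z y])
  also have "\<dots> \<le> lukasiewicz_tconorm ?a ?b"
    using weaker a b by (simp add: weaker_tconorm_def)
  also have "\<dots> \<le> ?a + ?b"
    by (simp add: lukasiewicz_tconorm_def)
  also have "\<dots> \<le> tconorm_dist S x y + tconorm_dist S y z"
    by (rule add_mono[OF residuum_le_tconorm_dist[OF x y] residuum_le_tconorm_dist[OF y z]])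
  finally show ?thesis .
qed

lemma Metric_space_tconorm_dist:
  assumes weaker: "weaker_tconorm S lukasiewicz_tconorm"
  shows "Metric_space {0..1} (tconorm_dist S)"
proof
  fix x y :: real
  show "0 \<le> tconorm_dist S x y"
  proof (cases "x \<in> {0..1} \<and> y \<in> {0..1}")
    case True
    then show ?thesis
      using tconorm_dist_in_unit[of x y] by simp
  next
    \<comment> \<open>Off the unit square the default value 0 applies.\<close>
    case False
    then show ?thesis
      by (auto simp: tconorm_dist_def)
  qed
next
  fix x y :: real
  show "tconorm_dist S x y = tconorm_dist S y x"
    by (rule tconorm_dist_commute)
next
  fix x y :: real
  assume "x \<in> {0..1}" "y \<in> {0..1}"
  then show "tconorm_dist S x y = 0 \<longleftrightarrow> x = y"
    by (rule tconorm_dist_eq_0_iff)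
next
  fix x y z :: real
  assume x: "x \<in> {0..1}" and y: "y \<in> {0..1}" and z: "z \<in> {0..1}"
  show "tconorm_dist S x z \<le> tconorm_dist S x y + tconorm_dist S y z"
  proof (cases "x \<le> z")
    case True
    then have "tconorm_dist S x z = residuum S x z"
      using x z by (simp add: tconorm_dist_def)
    then show ?thesis
      using residuum_le_dist_add_dist[OF weaker x y z] by simp
  next
    case False
    then have "tconorm_dist S x z = residuum S z x"
      using x z by (simp add: tconorm_dist_def)
    \<comment> \<open>Here the directed bound is used along the reversed path from \<open>z\<close>
      through \<open>y\<close> to \<open>x\<close>; symmetry restores the order of the
      arguments.\<close>
    then show ?thesis
      using residuum_le_dist_add_dist[OF weaker z y x]
      by (simp add: tconorm_dist_commute[of z y] tconorm_dist_commute[of y x])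
  qed
qed

end

theorem theorem6p2:
  fixes S :: "real \<Rightarrow> real \<Rightarrow> real"
  assumes "continuous_tconorm S"
  shows "(\<forall>x\<in>{0..1}. \<forall>y\<in>{0..1}. \<forall>z\<in>{0..1}.
            residuum S x y \<le> S (residuum S x z) (residuum S z y)) \<and>
         (\<forall>x\<in>{0..1}. \<forall>y\<in>{0..1}.
            tconorm_dist S x y \<in> {0..1} \<and>
            tconorm_dist S x y = S (residuum S x y) (residuum S y x)) \<and>
         (weaker_tconorm S lukasiewicz_tconorm \<longrightarrow>
            Metric_space {0..1} (tconorm_dist S))"
proof -
  interpret continuous_tconorm S by fact
  show ?thesis
    using residuum_transitive tconorm_dist_in_unit tconorm_dist_eq Metric_space_tconorm_dist
    by blast
qed

end
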